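(* Let $n\ge2$ be an integer and $p$ a prime not dividing $n$. Then $$P_{pn}(s,t)=\begin{cases}\dfrac{P_n(s^2+2t,\,-t^2)}{P_n(s,t)} & \text{if } p=2,\\[10pt] \dfrac{P_n\big(s\,P_{2p}(s,t),\,t^p\big)}{P_n(s,t)} & \text{if } p\ge3.\end{cases}$$
   Context: Let $\Phi_n(q)$ be the $n$th cyclotomic polynomial and $\phi$ the Euler totient function. For $n\ge 2$, $\Phi_n(q)$ is palindromic of degree $\phi(n)$ with constant term $1$, so there are unique complex numbers $\gamma_j$ with $\Phi_n(q)=\sum_{0\le j\le \phi(n)/2}\gamma_j q^j(1+q)^{\phi(n)-2j}$; the $n$th Lucas atom is $P_n(s,t)=\sum_j \gamma_j s^{\phi(n)-2j}(-t)^j$ for $n\ge 2$, and $P_1(s,t)=1$. $P_n(a,b)$ denotes $P_n$ with $s,t$ replaced by $a,b$. *)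

theory Defs
  imports
    Complex_Main
    "HOL-Number_Theory.Totient"
    "HOL-Computational_Algebra.Polynomial"
    "HOL-Computational_Algebra.Fraction_Field"
begin

text \<open>The product runs over the primitive \<open>n\<close>-th roots of unity \<open>exp(2\<pi>ik/n)\<close>.\<close>

definition cyclotomic_poly :: "nat \<Rightarrow> complex poly" where
  "cyclotomic_poly n = (\<Prod>k\<in>totatives n. [:- cis (2 * pi * real k / real n), 1:])"

text \<open>
  For \<open>n \<ge> 2\<close>, the coefficients of the cyclotomic polynomial in the basis
  \<open>q^j * (1 + q)^(totient n - 2 * j)\<close>, \<open>0 \<le> j \<le> totient n / 2\<close>. The sequence is set
  to zero outside this range so that it is unique as a function on \<open>nat\<close>.
\<close>

definition gamma_coeff :: "nat \<Rightarrow> nat \<Rightarrow> complex" where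
  "gamma_coeff n = (THE \<gamma>.
     (\<forall>j. j > totient n div 2 \<longrightarrow> \<gamma> j = 0) \<and>
     cyclotomic_poly n =
       (\<Sum>j\<le>totient n div 2. smult (\<gamma> j) ([:0, 1:] ^ j * (1 + [:0, 1:]) ^ (totient n - 2 * j))))"

text \<open>
  Polynomials in two variables \<open>s\<close>, \<open>t\<close> over the complex numbers are represented as
  \<open>\<complex>[s][t]\<close>: the inner variable is \<open>s\<close>, the outer one is \<open>t\<close>.
\<close>

type_synonym bipoly = "complex poly poly"

definition var_s :: bipoly where "var_s = [:[:0, 1:]:]"

definition var_t :: bipoly where "var_t = [:0, 1:]"

definition const_bipoly :: "complex \<Rightarrow> bipoly" where "const_bipoly c = [:[:c:]:]"

text \<open>\<open>bipoly_subst f a b\<close> is \<open>f(a, b)\<close>, i.e. \<open>f\<close> with \<open>s\<close>, \<open>t\<close> replaced by \<open>a\<close>, \<open>b\<close>.\<close>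

definition bipoly_subst :: "bipoly \<Rightarrow> bipoly \<Rightarrow> bipoly \<Rightarrow> bipoly" where
  "bipoly_subst f a b = poly (map_poly (\<lambda>g. poly (map_poly const_bipoly g) a) f) b"

text \<open>Only indices \<open>n \<ge> 1\<close> are meaningful; the value at \<open>n = 0\<close> is junk.\<close>

definition lucas_atom :: "nat \<Rightarrow> bipoly" where
  "lucas_atom n =
     (if n \<ge> 2
      then \<Sum>j\<le>totient n div 2.
             const_bipoly (gamma_coeff n j) * var_s ^ (totient n - 2 * j) * (- var_t) ^ j
      else 1)"

text \<open>The inclusion of \<open>\<complex>[s][t]\<close> into its field of fractions \<open>\<complex>(s, t)\<close>.\<close>

definition ratfun :: "bipoly \<Rightarrow> bipoly fract" where
  "ratfun f = Fraction_Field.Fract f 1"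

end

theory Submission
  imports Defs
begin

text \<open>Under \<open>s = x + y\<close>, \<open>t = - x * y\<close> the Lucas atom \<open>P_n(s, t)\<close> becomes the
  homogenized cyclotomic polynomial, i.e. the product of \<open>x - \<zeta> * y\<close> over the primitive \<open>n\<close>-th
  roots of unity \<open>\<zeta>\<close>. Both cases of the theorem thereby reduce to
  \<open>\<Phi>_n(x^p, y^p) = \<Phi>_(p n)(x, y) * \<Phi>_n(x, y)\<close>: for \<open>p = 2\<close> because
  \<open>s^2 + 2 * t = x^2 + y^2\<close>, and for odd \<open>p\<close> because the same identity with \<open>n = 2\<close> gives
  \<open>s * P_(2 p)(s, t) = x^p + y^p\<close>.\<close>

section \<open>Expansion of palindromic polynomials\<close>

lemma coeff_one_plus_X_power:
  "coeff ((1 + [:0, 1:] :: 'a::comm_ring_1 poly) ^ d) i = of_nat (d choose i)"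
proof (induction d arbitrary: i)
  case 0
  then show ?case by (cases i) auto
next
  case (Suc d)
  have "(1 + [:0, 1:] :: 'a poly) ^ Suc d
      = (1 + [:0, 1:]) ^ d + pCons 0 ((1 + [:0, 1:]) ^ d)"
    by (simp add: algebra_simps)
  then have "coeff ((1 + [:0, 1:] :: 'a poly) ^ Suc d) i
      = coeff ((1 + [:0, 1:]) ^ d) i + coeff (pCons 0 ((1 + [:0, 1:]) ^ d)) i"
    by (simp only: coeff_add)
  then show ?case
    by (cases i) (simp_all add: Suc)
qed

text \<open>Subtracting \<open>f(0) * (1 + X)^d\<close> removes the constant coefficient and, by
  symmetry, the one at \<open>d\<close>; the rest is \<open>X\<close> times a polynomial symmetric
  about \<open>(d - 2) / 2\<close>, so induction applies. Here \<open>d\<close> is an upper bound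
  for the degree rather than the degree itself, because the degree may drop further in the
  induction.\<close>

lemma palindromic_expansion:
  fixes f :: "'a::comm_ring_1 poly"
  assumes "\<And>i. i > d \<Longrightarrow> coeff f i = 0"
    and "\<And>i. i \<le> d \<Longrightarrow> coeff f (d - i) = coeff f i"
  shows "\<exists>\<gamma>. (\<forall>j. j > d div 2 \<longrightarrow> \<gamma> j = 0) \<and>
    f = (\<Sum>j\<le>d div 2. smult (\<gamma> j) ([:0, 1:] ^ j * (1 + [:0, 1:]) ^ (d - 2 * j)))"
  using assms
proof (induction d arbitrary: f rule: less_induct)
  case (less d)
  show ?case
  proof (cases "d \<ge> 2")
    case False
    then have d: "d div 2 = 0" by simp
    have "f = smult (coeff f 0) ((1 + [:0, 1:]) ^ d)"
    proof (rule poly_eqI)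
      fix i
      consider "d = 0" | "d = 1" using False by linarith
      then show "coeff f i = coeff (smult (coeff f 0) ((1 + [:0, 1:]) ^ d)) i"
      proof cases
        case 1
        then show ?thesis using less.prems(1)[of i] by (cases i) auto
      next
        case 2
        then show ?thesis using less.prems(1)[of i] less.prems(2)[of 0]
          unfolding coeff_smult coeff_one_plus_X_power
          by (cases "i = 0 \<or> i = 1") (auto simp: binomial_eq_0)
      qed
    qed
    then show ?thesis
      by (intro exI[of _ "\<lambda>j. if j = 0 then coeff f 0 else 0"]) (simp add: d)
  next
    case True
    define g where "g = f - smult (coeff f 0) ((1 + [:0, 1:]) ^ d)"
    have g_coeff: "coeff g i = coeff f i - coeff f 0 * of_nat (d choose i)" for i
      by (simp add: g_def coeff_one_plus_X_power)
    have g_pal: "coeff g (d - i) = coeff g i" if "i \<le> d" for i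
      using less.prems(2)[OF that] by (simp add: g_coeff binomial_symmetric[OF that])
    obtain h where h: "g = pCons 0 h"
      using g_coeff[of 0] by (cases g) auto
    have h_coeff: "coeff h i = coeff g (Suc i)" for i
      by (simp add: h)
    have "\<exists>\<gamma>. (\<forall>j. j > (d - 2) div 2 \<longrightarrow> \<gamma> j = 0) \<and>
      h = (\<Sum>j\<le>(d - 2) div 2. smult (\<gamma> j) ([:0, 1:] ^ j * (1 + [:0, 1:]) ^ (d - 2 - 2 * j)))"
    proof (rule less.IH)
      show "d - 2 < d" using True by simp
    next
      fix i assume "i > d - 2"
      \<comment> \<open>At index \<open>d\<close> the coefficient of \<open>g\<close> equals the one
        at 0 by symmetry, and that one was cancelled.\<close>
      then have "Suc i = d \<or> Suc i > d" using True by linarith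
      then show "coeff h i = 0"
        using g_pal[of d] g_pal[of 0] less.prems(1)[of "Suc i"]
        by (auto simp: h_coeff g_coeff binomial_eq_0)
    next
      fix i assume "i \<le> d - 2"
      then have "Suc (d - 2 - i) = d - Suc i" "Suc i \<le> d" using True by linarith+
      then show "coeff h (d - 2 - i) = coeff h i"
        using g_pal[of "Suc i"] by (simp add: h_coeff)
    qed
    then obtain \<gamma> where \<gamma>: "\<And>j. j > (d - 2) div 2 \<Longrightarrow> \<gamma> j = 0"
      "h = (\<Sum>j\<le>(d - 2) div 2. smult (\<gamma> j) ([:0, 1:] ^ j * (1 + [:0, 1:]) ^ (d - 2 - 2 * j)))"
      by blast
    have d2: "d div 2 = Suc ((d - 2) div 2)" using True by simp
    have "f = smult (coeff f 0) ((1 + [:0, 1:]) ^ d) + [:0, 1:] * h"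
      using h by (simp add: g_def algebra_simps)
    \<comment> \<open>Since \<open>d - 2 - 2 * j = d - 2 * Suc j\<close>, multiplication by
      \<open>X\<close> shifts the expansion of \<open>h\<close> by one index, which leaves index 0
      free for \<open>f(0)\<close>.\<close>
    also have "[:0, 1:] * h = (\<Sum>j\<le>(d - 2) div 2.
        smult (\<gamma> j) ([:0, 1:] ^ Suc j * (1 + [:0, 1:]) ^ (d - 2 * Suc j)))"
      unfolding \<gamma>(2) sum_distrib_left by (intro sum.cong refl) (simp add: algebra_simps)
    finally have "f = (\<Sum>j\<le>d div 2. smult (case j of 0 \<Rightarrow> coeff f 0 | Suc i \<Rightarrow> \<gamma> i)
        ([:0, 1:] ^ j * (1 + [:0, 1:]) ^ (d - 2 * j)))"
      unfolding d2 sum.atMost_Suc_shift by simp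
    moreover have "(case j of 0 \<Rightarrow> coeff f 0 | Suc i \<Rightarrow> \<gamma> i) = 0" if "j > d div 2" for j
      using that \<gamma>(1) by (cases j) (auto simp: d2)
    ultimately show ?thesis by blast
  qed
qed

text \<open>The \<open>j\<close>-th basis polynomial has lowest term \<open>X^j\<close> with
  coefficient 1, so comparing coefficients gives a unitriangular system, whatever the exponents
  \<open>e j\<close> are.\<close>

lemma palindromic_expansion_unique:
  fixes \<gamma> \<delta> :: "nat \<Rightarrow> 'a::comm_ring_1"
  assumes "(\<Sum>j\<le>m. smult (\<gamma> j) ([:0, 1:] ^ j * (1 + [:0, 1:]) ^ e j)) =
           (\<Sum>j\<le>m. smult (\<delta> j) ([:0, 1:] ^ j * (1 + [:0, 1:]) ^ e j))"
    and "j \<le> m"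
  shows "\<gamma> j = \<delta> j"
  using assms(2)
proof (induction j rule: less_induct)
  case (less k)
  define B where "B j = ([:0, 1:] ^ j * (1 + [:0, 1:]) ^ e j :: 'a poly)" for j
  \<comment> \<open>Reading \<open>X^j\<close> as a monomial turns the product into a shift of the
    binomial coefficients by \<open>j\<close>.\<close>
  have B: "coeff (B j) i = (if i < j then 0 else of_nat (e j choose (i - j)))" for i j
    by (simp add: B_def coeff_one_plus_X_power coeff_monom_mult flip: monom_altdef[of 1, simplified])
  have split: "coeff (\<Sum>j\<le>m. smult (a j) (B j)) k = (\<Sum>j<k. a j * coeff (B j) k) + a k"
    for a :: "nat \<Rightarrow> 'a"
  proof -
    have "coeff (\<Sum>j\<le>m. smult (a j) (B j)) k = (\<Sum>j\<le>m. a j * coeff (B j) k)"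
      by (simp add: coeff_sum)
    also have "\<dots> = (\<Sum>j\<le>k. a j * coeff (B j) k)"
      using less.prems by (intro sum.mono_neutral_right) (auto simp: B)
    also have "\<dots> = (\<Sum>j<k. a j * coeff (B j) k) + a k"
      by (simp add: B flip: lessThan_Suc_atMost)
    finally show ?thesis .
  qed
  have "(\<Sum>j<k. \<gamma> j * coeff (B j) k) + \<gamma> k = (\<Sum>j<k. \<delta> j * coeff (B j) k) + \<delta> k"
    using assms(1) unfolding B_def[symmetric] by (simp flip: split)
  moreover have "(\<Sum>j<k. \<gamma> j * coeff (B j) k) = (\<Sum>j<k. \<delta> j * coeff (B j) k)"
    using less by (intro sum.cong) auto
  ultimately show ?case by simp
qed

section \<open>Cyclotomic polynomials\<close>

lemma degree_cyclotomic_poly: "degree (cyclotomic_poly n) = totient n"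
  by (simp add: cyclotomic_poly_def totient_def degree_prod_sum_eq)

lemma cis_rat_eq_1D:
  assumes "cis (2 * pi * real k / real n) = 1" "n > 0"
  shows "n dvd k"
proof -
  have "cos (2 * pi * real k / real n) = 1"
    using assms(1) by (simp add: complex_eq_iff)
  then obtain z :: int where "2 * pi * real k / real n = z * 2 * pi"
    by (auto simp: cos_one_2pi_int)
  then have "real k = z * real n"
    using assms(2) by (simp add: field_simps)
  then have "int k = z * int n"
    by (metis of_int_eq_iff of_int_mult of_int_of_nat_eq)
  then show ?thesis
    by (metis dvd_triv_right int_dvd_int_iff)
qed

text \<open>A root at 1 would make some primitive \<open>n\<close>-th root of unity equal to 1,
  which forces \<open>n = 1\<close>. This allows cancelling the value at 1 when the reflected
  polynomial is compared with the original.\<close>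

lemma poly_cyclotomic_poly_1_nonzero:
  assumes "n \<ge> 2"
  shows "poly (cyclotomic_poly n) 1 \<noteq> 0"
proof -
  have "cis (2 * pi * real k / real n) \<noteq> 1" if "k \<in> totatives n" for k
  proof
    assume "cis (2 * pi * real k / real n) = 1"
    then have "n dvd k" using assms by (intro cis_rat_eq_1D) auto
    moreover have "coprime k n" using that by (simp add: in_totatives_iff)
    ultimately have "n = 1"
      using coprime_absorb_left[of n k] coprime_commute[of n k] by simp
    then show False using assms by simp
  qed
  then show ?thesis
    by (auto simp: cyclotomic_poly_def poly_prod)
qed

lemma reflect_linear_cis:
  "reflect_poly [:- cis t, 1:] = smult (- cis t) [:- cis (- t), 1:]"
  by (subst reflect_poly_pCons) (auto simp: cis_mult)

text \<open>Inversion permutes the primitive roots, so the reflected polynomial is a scalar multiple of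
  the original one; the scalar is found to be 1 by evaluating at 1.\<close>

lemma reflect_cyclotomic_poly:
  assumes "n \<ge> 2"
  shows "reflect_poly (cyclotomic_poly n) = cyclotomic_poly n"
proof -
  define \<zeta> where "\<zeta> k = cis (2 * pi * real k / real n)" for k
  have inv: "cis (- (2 * pi * real k / real n)) = \<zeta> (n - k)" if "k \<in> totatives n" for k
  proof -
    have "k \<le> n" using that by (rule totatives_le)
    then have eq: "2 * pi * real (n - k) / real n = 2 * pi + - (2 * pi * real k / real n)"
      using assms by (simp add: of_nat_diff field_simps)
    show ?thesis
      unfolding \<zeta>_def eq cis_mult[of "2 * pi", symmetric] by simp
  qed
  define c where "c = (\<Prod>k\<in>totatives n. - \<zeta> k)"
  have "reflect_poly (cyclotomic_poly n)
      = (\<Prod>k\<in>totatives n. smult (- \<zeta> k) [:- \<zeta> (n - k), 1:])"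
    unfolding cyclotomic_poly_def reflect_poly_prod
    by (intro prod.cong refl) (simp only: reflect_linear_cis inv \<zeta>_def)
  also have "\<dots> = smult c (\<Prod>k\<in>totatives n. [:- \<zeta> (n - k), 1:])"
    by (simp only: prod_smult c_def)
  also have "(\<Prod>k\<in>totatives n. [:- \<zeta> (n - k), 1:]) = cyclotomic_poly n"
    unfolding cyclotomic_poly_def
  proof (rule prod.reindex_bij_witness[of _ "\<lambda>k. n - k" "\<lambda>k. n - k"])
    fix k assume k: "k \<in> totatives n"
    \<comment> \<open>For \<open>n \<ge> 2\<close> the endpoint \<open>n\<close> is not a totative,
      so \<open>n - k\<close> stays positive.\<close>
    have "k < n" using totatives_less[OF k] assms by simp
    from \<open>k < n\<close> show "n - (n - k) = k" "n - (n - k) = k" by auto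
    have "coprime (n - k) n"
    proof (rule coprimeI)
      fix d assume "d dvd n - k" "d dvd n"
      moreover from this have "d dvd k" using \<open>k < n\<close> dvd_diffD1[of d n k] by simp
      ultimately show "is_unit d"
        using k by (meson coprime_common_divisor in_totatives_iff)
    qed
    then show "n - k \<in> totatives n" "n - k \<in> totatives n"
      using \<open>k < n\<close> by (auto simp: in_totatives_iff)
    show "[:- cis (2 * pi * real (n - k) / real n), 1:] = [:- \<zeta> (n - k), 1:]"
      by (simp add: \<zeta>_def)
  qed
  finally have eq: "reflect_poly (cyclotomic_poly n) = smult c (cyclotomic_poly n)" .
  have "poly (cyclotomic_poly n) 1 = c * poly (cyclotomic_poly n) 1"
    using poly_reflect_poly_nz[of 1 "cyclotomic_poly n"] unfolding eq by simp
  then have "c = 1"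
    using poly_cyclotomic_poly_1_nonzero[OF assms] by (metis mult_cancel_right1)
  then show ?thesis using eq by simp
qed

text \<open>Existence of the coefficients comes from palindromicity. The triangular system fixes
  them inside the range and the zero convention outside it, so the definite description is well
  defined.\<close>

lemma cyclotomic_poly_gamma_coeff:
  assumes "n \<ge> 2"
  shows "cyclotomic_poly n = (\<Sum>j\<le>totient n div 2.
    smult (gamma_coeff n j) ([:0, 1:] ^ j * (1 + [:0, 1:]) ^ (totient n - 2 * j)))"
proof -
  let ?P = "\<lambda>\<gamma>. (\<forall>j. j > totient n div 2 \<longrightarrow> \<gamma> j = 0) \<and> cyclotomic_poly n =
    (\<Sum>j\<le>totient n div 2. smult (\<gamma> j) ([:0, 1:] ^ j * (1 + [:0, 1:]) ^ (totient n - 2 * j)))"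
  have "\<exists>\<gamma>. ?P \<gamma>"
  proof (rule palindromic_expansion)
    fix i assume "totient n < i"
    then show "coeff (cyclotomic_poly n) i = 0"
      by (intro coeff_eq_0) (simp add: degree_cyclotomic_poly)
  next
    fix i assume "i \<le> totient n"
    then show "coeff (cyclotomic_poly n) (totient n - i) = coeff (cyclotomic_poly n) i"
      using arg_cong[OF reflect_cyclotomic_poly[OF assms], of "\<lambda>f. coeff f i"]
      by (simp add: coeff_reflect_poly degree_cyclotomic_poly)
  qed
  moreover have "\<gamma> = \<delta>" if "?P \<gamma>" "?P \<delta>" for \<gamma> \<delta>
  proof
    fix j
    show "\<gamma> j = \<delta> j"
    proof (cases "j \<le> totient n div 2")
      case True
      show ?thesis
        by (rule palindromic_expansion_unique[OF _ True, where e = "\<lambda>j. totient n - 2 * j"])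
          (use that in metis)
    qed (use that in auto)
  qed
  ultimately have "\<exists>!\<gamma>. ?P \<gamma>" by blast
  from theI'[OF this] show ?thesis unfolding gamma_coeff_def by blast
qed

section \<open>The homogenized cyclotomic polynomial and its behaviour under prime powers of the
  variables\<close>

definition cyclotomic_form :: "nat \<Rightarrow> complex \<Rightarrow> complex \<Rightarrow> complex" where
  "cyclotomic_form n x y = (\<Prod>k\<in>totatives n. x - cis (2 * pi * real k / real n) * y)"

lemma cyclotomic_form_2: "cyclotomic_form 2 x y = x + y"
proof -
  have "totatives 2 = {1::nat}" by (auto simp: totatives_prime)
  then show ?thesis by (simp add: cyclotomic_form_def)
qed

lemma cyclotomic_form_eq:
  assumes "y \<noteq> 0"
  shows "cyclotomic_form n x y = y ^ totient n * poly (cyclotomic_poly n) (x / y)"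
proof -
  have "cyclotomic_form n x y =
      (\<Prod>k\<in>totatives n. y * poly [:- cis (2 * pi * real k / real n), 1:] (x / y))"
    unfolding cyclotomic_form_def
    by (intro prod.cong refl) (use assms in \<open>simp add: field_simps\<close>)
  then show ?thesis
    by (simp add: prod.distrib totient_def cyclotomic_poly_def poly_prod)
qed

text \<open>This is the factorization of \<open>X^m - 1\<close> over the \<open>m\<close>-th roots
  of unity, evaluated at \<open>x / y\<close> and scaled by \<open>y^m\<close>; hence the separate
  case \<open>y = 0\<close>.\<close>

lemma power_diff_eq_prod_roots:
  assumes "m > 0"
  shows "x ^ m - y ^ m = (\<Prod>i<m. x - cis (2 * pi * real i / real m) * y)"
proof (cases "y = 0")
  case True
  then show ?thesis using assms by simp
next
  case False
  let ?\<zeta> = "\<lambda>i. cis (2 * pi * real i / real m)"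
  let ?Q = "\<Prod>i<m. [:- ?\<zeta> i, 1:]"
  have "monom 1 m - 1 = ?Q"
  \<comment> \<open>Both sides have degree at most \<open>m\<close> and the same coefficient at
    \<open>m\<close>, so their difference has fewer than \<open>m\<close> roots unless it vanishes;
    the \<open>m\<close> roots of unity are all roots of it.\<close>
  proof (rule poly_eqI_degree_lead_coeff[where n = m and A = "{z. z ^ m = 1}"])
    show "degree ?Q \<le> m"
      by (simp add: degree_prod_sum_eq)
    show "degree (monom 1 m - 1 :: complex poly) \<le> m"
      by (intro degree_diff_le) (auto simp: degree_monom_le)
    show "coeff (monom 1 m - 1) m = coeff ?Q m"
    proof -
      have deg: "degree ?Q = m" by (simp add: degree_prod_sum_eq)
      have "lead_coeff ?Q = 1" by (simp add: lead_coeff_prod)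
      then have "coeff ?Q m = 1" unfolding deg .
      then show ?thesis using assms by simp
    qed
    show "card {z::complex. z ^ m = 1} \<ge> m"
      using card_roots_unity_eq[OF assms] by simp
    fix z :: complex assume "z \<in> {z. z ^ m = 1}"
    then have "z \<in> ?\<zeta> ` {..<m}" "z ^ m = 1"
      using bij_betw_roots_unity[OF assms] by (auto simp: bij_betw_def)
    then show "poly (monom 1 m - 1) z = poly ?Q z"
      by (auto simp: poly_monom poly_prod)
  qed
  then have "y ^ m * ((x / y) ^ m - 1) = y ^ m * poly ?Q (x / y)"
    by (metis poly_monom poly_diff poly_1 mult_1)
  also have "\<dots> = (\<Prod>i<m. y * (x / y - ?\<zeta> i))"
    by (simp add: poly_prod prod.distrib)
  also have "\<dots> = (\<Prod>i<m. x - ?\<zeta> i * y)"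
    by (intro prod.cong refl) (use False in \<open>simp add: field_simps\<close>)
  finally have "y ^ m * ((x / y) ^ m - 1) = (\<Prod>i<m. x - ?\<zeta> i * y)" .
  moreover have "y ^ m * ((x / y) ^ m - 1) = x ^ m - y ^ m"
    using False by (simp add: power_divide right_diff_distrib)
  ultimately show ?thesis by simp
qed

text \<open>Both sides are the product of \<open>x - cis (2 * pi * m / (p * n)) * y\<close> over all
  \<open>0 < m \<le> p * n\<close> coprime to \<open>n\<close>: the left-hand side groups them by residue modulo \<open>n\<close>, the
  right-hand side by divisibility by \<open>p\<close>.\<close>

lemma cyclotomic_form_power:
  assumes n: "n \<ge> 2" and p: "prime p" and np: "\<not> p dvd n"
  shows "cyclotomic_form n (x ^ p) (y ^ p) = cyclotomic_form (p * n) x y * cyclotomic_form n x y"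
proof -
  have p0: "p > 0" using p by (simp add: prime_gt_0_nat)
  define M where "M = {m \<in> {0<..p * n}. coprime m n}"
  define w where "w m = cis (2 * pi * real m / real (p * n))" for m
  have "cyclotomic_form n (x ^ p) (y ^ p) = (\<Prod>k\<in>totatives n. \<Prod>i<p. x - w (k + i * n) * y)"
    unfolding cyclotomic_form_def
  proof (intro prod.cong refl)
    fix k
    \<comment> \<open>\<open>w k\<close> is one \<open>p\<close>-th root of the given root of unity,
      and its multiples by the \<open>p\<close>-th roots of unity are the
      \<open>w (k + i * n)\<close>. So each factor splits as a difference of \<open>p\<close>-th
      powers.\<close>
    have "cis (2 * pi * real k / real n) * y ^ p = (w k * y) ^ p"
      using p0 n by (simp add: w_def power_mult_distrib DeMoivre)
    moreover have "cis (2 * pi * real i / real p) * (w k * y) = w (k + i * n) * y" for i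
    proof -
      have "2 * pi * real i / real p + 2 * pi * real k / real (p * n)
          = 2 * pi * real (k + i * n) / real (p * n)"
        using p0 n by (simp add: field_simps)
      then have "cis (2 * pi * real i / real p) * w k = w (k + i * n)"
        by (simp only: w_def cis_mult)
      then show ?thesis by (metis mult.assoc)
    qed
    ultimately show "x ^ p - cis (2 * pi * real k / real n) * y ^ p
        = (\<Prod>i<p. x - w (k + i * n) * y)"
      by (simp only: power_diff_eq_prod_roots[OF p0])
  qed
  also have "\<dots> = (\<Prod>(k, i)\<in>totatives n \<times> {..<p}. x - w (k + i * n) * y)"
    by (simp add: prod.cartesian_product)
  also have "\<dots> = (\<Prod>m\<in>M. x - w m * y)"
  \<comment> \<open>Division with remainder by \<open>n\<close> is the bijection: \<open>k\<close>
    is the remainder and \<open>i\<close> the quotient.\<close>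
  proof (rule prod.reindex_bij_witness[of _ "\<lambda>m. (m mod n, m div n)" "\<lambda>(k, i). k + i * n"])
    fix a assume "a \<in> totatives n \<times> {..<p}"
    then obtain k i where a: "a = (k, i)" "k \<in> totatives n" "i < p" by auto
    have k: "0 < k" "k < n" "coprime k n"
      using a(2) n totatives_less[of k n] by (auto simp: in_totatives_iff)
    show "(case a of (k, i) \<Rightarrow> k + i * n) \<in> M"
    proof -
      have "k + i * n \<le> Suc i * n" using k by simp
      also have "\<dots> \<le> p * n" using a(3) by (intro mult_right_mono) auto
      finally have "k + i * n \<le> p * n" .
      moreover have "coprime (k + i * n) n"
        using k(3) by (simp add: coprime_iff_gcd_eq_1 gcd.commute[of _ n] gcd_add_mult
            add.commute[of k])
      ultimately show ?thesis using a k by (simp add: M_def)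
    qed
    show "((case a of (k, i) \<Rightarrow> k + i * n) mod n, (case a of (k, i) \<Rightarrow> k + i * n) div n) = a"
      using a k by simp
    show "x - w (case a of (k, i) \<Rightarrow> k + i * n) * y
        = (case a of (k, i) \<Rightarrow> x - w (k + i * n) * y)"
      by (simp add: a)
  next
    fix m assume m: "m \<in> M"
    show "(case (m mod n, m div n) of (k, i) \<Rightarrow> k + i * n) = m" by simp
    have "coprime (m mod n) n" using m n by (simp add: M_def)
    then have "m mod n > 0" using n by (intro Nat.gr0I) auto
    \<comment> \<open>The right endpoint of the interval is the only value with quotient
      \<open>p\<close>; it is excluded because its remainder is 0.\<close>
    have "m \<noteq> p * n" using \<open>m mod n > 0\<close> by auto
    then have "m < p * n" using m by (simp add: M_def)
    then have "m div n < p" using n by (simp add: less_mult_imp_div_less)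
    then show "(m mod n, m div n) \<in> totatives n \<times> {..<p}"
      using \<open>coprime (m mod n) n\<close> \<open>m mod n > 0\<close> n
      by (simp add: in_totatives_iff less_imp_le)
  qed
  also have "M = totatives (p * n) \<union> (*) p ` totatives n"
  proof (intro equalityI subsetI)
    fix m assume m: "m \<in> M"
    show "m \<in> totatives (p * n) \<union> (*) p ` totatives n"
    proof (cases "p dvd m")
      case True
      then obtain k where "m = p * k" by blast
      then show ?thesis using m p0 by (auto simp: M_def in_totatives_iff)
    next
      case False
      then have "coprime m p" using p by (metis prime_imp_coprime coprime_commute)
      then show ?thesis using m by (auto simp: M_def in_totatives_iff)
    qed
  next
    fix m assume "m \<in> totatives (p * n) \<union> (*) p ` totatives n"
    \<comment> \<open>Since \<open>p\<close> does not divide \<open>n\<close>, multiplying a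
      totative of \<open>n\<close> by \<open>p\<close> keeps it coprime to \<open>n\<close>.\<close>
    moreover have "coprime p n" using p np by (simp add: prime_imp_coprime)
    ultimately show "m \<in> M" using p0 by (auto simp: M_def in_totatives_iff)
  qed
  also have "(\<Prod>m\<in>totatives (p * n) \<union> (*) p ` totatives n. x - w m * y)
      = (\<Prod>m\<in>totatives (p * n). x - w m * y) * (\<Prod>m\<in>(*) p ` totatives n. x - w m * y)"
  proof (rule prod.union_disjoint)
    have "\<not> coprime (p * k) (p * n)" for k
      using p by (metis coprime_common_divisor dvd_triv_left not_prime_unit)
    then show "totatives (p * n) \<inter> (*) p ` totatives n = {}"
      by (auto simp: in_totatives_iff)
  qed auto
  also have "(\<Prod>m\<in>(*) p ` totatives n. x - w m * y) = cyclotomic_form n x y"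
    using p0 by (subst prod.reindex) (auto simp: inj_on_def w_def cyclotomic_form_def mult.assoc)
  finally show ?thesis by (simp add: w_def cyclotomic_form_def)
qed

section \<open>Evaluation of bivariate polynomials\<close>

definition bipoly_eval :: "bipoly \<Rightarrow> complex \<Rightarrow> complex \<Rightarrow> complex" where
  "bipoly_eval f a b = poly (poly f [:b:]) a"

lemma bipoly_eval_simps [simp]:
  "bipoly_eval (f + g) a b = bipoly_eval f a b + bipoly_eval g a b"
  "bipoly_eval (f - g) a b = bipoly_eval f a b - bipoly_eval g a b"
  "bipoly_eval (- f) a b = - bipoly_eval f a b"
  "bipoly_eval (f * g) a b = bipoly_eval f a b * bipoly_eval g a b"
  "bipoly_eval (f ^ m) a b = bipoly_eval f a b ^ m"
  "bipoly_eval (sum h A) a b = (\<Sum>i\<in>A. bipoly_eval (h i) a b)"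
  "bipoly_eval var_s a b = a"
  "bipoly_eval var_t a b = b"
  "bipoly_eval (const_bipoly c) a b = c"
  "bipoly_eval 0 a b = 0"
  "bipoly_eval (numeral v) a b = numeral v"
  by (simp_all add: bipoly_eval_def poly_sum var_s_def var_t_def const_bipoly_def)

text \<open>With this, identities involving substituted polynomials can be checked on complex
  values. The proof is a double induction: first over the coefficients in \<open>s\<close>, then
  over the powers of \<open>t\<close>.\<close>

lemma bipoly_eval_subst:
  "bipoly_eval (bipoly_subst f A B) a b = bipoly_eval f (bipoly_eval A a b) (bipoly_eval B a b)"
proof -
  have inner: "bipoly_eval (poly (map_poly const_bipoly g) A) a b = poly g (bipoly_eval A a b)"
    for g
  proof (induction g)
    case (pCons c g)
    have "map_poly const_bipoly (pCons c g) = pCons (const_bipoly c) (map_poly const_bipoly g)"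
      by (rule map_poly_pCons) (simp add: const_bipoly_def)
    then show ?case by (simp add: pCons.IH)
  qed simp
  show ?thesis
  proof (induction f)
    case 0
    then show ?case by (simp add: bipoly_subst_def)
  next
    case (pCons g f)
    have "bipoly_subst (pCons g f) A B
        = poly (map_poly const_bipoly g) A + B * bipoly_subst f A B"
      unfolding bipoly_subst_def by (subst map_poly_pCons) auto
    then show ?case
      using pCons.IH inner[of g] by (simp add: bipoly_eval_def)
  qed
qed

text \<open>The parametrization \<open>s = x + y\<close>, \<open>t = - x * y\<close> covers all pairs, by solving a quadratic
  equation; the pairs with \<open>t \<noteq> 0\<close> already determine a polynomial.\<close>

lemma bipoly_eqI:
  assumes "\<And>x y. y \<noteq> 0 \<Longrightarrow> x \<noteq> 0 \<Longrightarrow>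
    bipoly_eval f (x + y) (- (x * y)) = bipoly_eval g (x + y) (- (x * y))"
  shows "f = g"
proof -
  have eval: "bipoly_eval (f - g) a b = 0" if "b \<noteq> 0" for a b
  proof -
    \<comment> \<open>\<open>r\<close> is a square root of the discriminant of
      \<open>z^2 - a * z - b\<close>, so \<open>x\<close> and \<open>y\<close> are its two
      roots.\<close>
    define r where "r = csqrt (a\<^sup>2 + 4 * b)"
    define x where "x = (a + r) / 2"
    define y where "y = (a - r) / 2"
    have r2: "r\<^sup>2 = a\<^sup>2 + 4 * b" by (simp add: r_def)
    have "- (x * y) = (r\<^sup>2 - a\<^sup>2) / 4"
      by (simp add: x_def y_def power2_eq_square field_simps)
    then have "- (x * y) = b" using r2 by simp
    moreover have "x + y = a" by (simp add: x_def y_def field_simps)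
    moreover have "x \<noteq> 0" "y \<noteq> 0" using \<open>- (x * y) = b\<close> that by auto
    ultimately show ?thesis using assms[of y x] by simp
  qed
  \<comment> \<open>As a polynomial in \<open>t\<close> over \<open>\<complex>[s]\<close>,
    \<open>f - g\<close> has every nonzero constant as a root. These are infinitely many roots in an
    integral domain, so it is zero.\<close>
  have "poly (f - g) [:b:] = 0" if "b \<noteq> 0" for b
    using eval[OF that] by (intro iffD1[OF poly_all_0_iff_0]) (simp add: bipoly_eval_def)
  then have "(\<lambda>b. [:b:]) ` (- {0}) \<subseteq> {c. poly (f - g) c = 0}" by auto
  moreover have "infinite ((\<lambda>b::complex. [:b:]) ` (- {0}))"
    by (subst finite_image_iff) (auto simp: inj_on_def infinite_UNIV_char_0 Compl_eq_Diff_UNIV)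
  ultimately have "f - g = 0"
    using poly_roots_finite[of "f - g"] finite_subset by blast
  then show ?thesis by simp
qed

section \<open>Lucas atoms as cyclotomic forms and the resulting product identities\<close>

lemma bipoly_eval_lucas_atom:
  assumes "n \<ge> 2" and "y \<noteq> 0"
  shows "bipoly_eval (lucas_atom n) (x + y) (- (x * y)) = cyclotomic_form n x y"
proof -
  let ?d = "totient n"
  have "cyclotomic_form n x y = (\<Sum>j\<le>?d div 2.
      y ^ ?d * (gamma_coeff n j * ((x / y) ^ j * (1 + x / y) ^ (?d - 2 * j))))"
    by (simp add: cyclotomic_form_eq[OF assms(2)] cyclotomic_poly_gamma_coeff[OF assms(1)]
        poly_sum sum_distrib_left)
  also have "\<dots> = (\<Sum>j\<le>?d div 2. gamma_coeff n j * (x + y) ^ (?d - 2 * j) * (x * y) ^ j)"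
  proof (intro sum.cong refl)
    fix j assume "j \<in> {..?d div 2}"
    \<comment> \<open>The bound \<open>2 * j \<le> ?d\<close> lets \<open>y ^ ?d\<close> be shared
      out: \<open>y^(?d - 2 * j)\<close> clears the denominators of \<open>1 + x / y\<close>, and
      \<open>y^(2 * j)\<close> turns \<open>(x / y)^j\<close> into \<open>(x * y)^j\<close>.\<close>
    then have "y ^ ?d = y ^ (?d - 2 * j) * (y * y) ^ j"
      by (simp flip: power_add power2_eq_square power_mult)
    moreover have "(y * y) ^ j * (x / y) ^ j = (x * y) ^ j"
      using assms(2) by (simp add: mult.commute flip: power_mult_distrib)
    moreover have "y ^ (?d - 2 * j) * (1 + x / y) ^ (?d - 2 * j) = (x + y) ^ (?d - 2 * j)"
      using assms(2) by (simp add: field_simps flip: power_mult_distrib)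
    ultimately show "y ^ ?d * (gamma_coeff n j * ((x / y) ^ j * (1 + x / y) ^ (?d - 2 * j)))
        = gamma_coeff n j * (x + y) ^ (?d - 2 * j) * (x * y) ^ j"
      by (simp add: mult_ac)
  qed
  finally show ?thesis using assms(1) by (simp add: lucas_atom_def)
qed

text \<open>At \<open>x = 2\<close>, \<open>y = 1\<close> the value is a product of factors
  \<open>2 - \<zeta>\<close> with \<open>\<zeta>\<close> of modulus 1, none of which
  vanishes.\<close>

lemma lucas_atom_nonzero:
  assumes "n \<ge> 2"
  shows "lucas_atom n \<noteq> 0"
proof
  assume "lucas_atom n = 0"
  then have "cyclotomic_form n 2 1 = 0"
    using bipoly_eval_lucas_atom[OF assms, of 1 2] by simp
  then obtain k where "cis (2 * pi * real k / real n) = 2"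
    by (auto simp: cyclotomic_form_def)
  then have "norm (2 :: complex) = 1" by (metis norm_cis)
  then show False by simp
qed

lemma lucas_atom_mult_two:
  assumes "n \<ge> 2" and "odd n"
  shows "lucas_atom (2 * n) * lucas_atom n =
    bipoly_subst (lucas_atom n) (var_s ^ 2 + 2 * var_t) (- (var_t ^ 2))"
proof (rule bipoly_eqI)
  fix x y :: complex assume y: "y \<noteq> 0"
  \<comment> \<open>The substituted arguments are the parametrization belonging to the pair of
    squares of \<open>x\<close> and \<open>y\<close>.\<close>
  have sq: "(x + y)\<^sup>2 + 2 * (- (x * y)) = x\<^sup>2 + y\<^sup>2" "- ((- (x * y))\<^sup>2) = - (x\<^sup>2 * y\<^sup>2)"
    by (simp_all add: power2_eq_square algebra_simps)
  have "bipoly_eval (bipoly_subst (lucas_atom n) (var_s ^ 2 + 2 * var_t) (- (var_t ^ 2)))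
      (x + y) (- (x * y)) = bipoly_eval (lucas_atom n) (x\<^sup>2 + y\<^sup>2) (- (x\<^sup>2 * y\<^sup>2))"
    by (simp only: bipoly_eval_subst bipoly_eval_simps sq)
  also have "\<dots> = cyclotomic_form n (x\<^sup>2) (y\<^sup>2)"
    using assms y by (intro bipoly_eval_lucas_atom) auto
  also have "\<dots> = cyclotomic_form (2 * n) x y * cyclotomic_form n x y"
    using assms by (intro cyclotomic_form_power) auto
  finally show "bipoly_eval (lucas_atom (2 * n) * lucas_atom n) (x + y) (- (x * y)) =
      bipoly_eval (bipoly_subst (lucas_atom n) (var_s ^ 2 + 2 * var_t) (- (var_t ^ 2)))
      (x + y) (- (x * y))"
    using assms y by (simp add: bipoly_eval_lucas_atom)
qed

lemma lucas_atom_mult_odd_prime: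
  assumes "n \<ge> 2" and "prime p" and "\<not> p dvd n" and "p \<noteq> 2"
  shows "lucas_atom (p * n) * lucas_atom n =
    bipoly_subst (lucas_atom n) (var_s * lucas_atom (2 * p)) (var_t ^ p)"
proof (rule bipoly_eqI)
  fix x y :: complex assume y: "y \<noteq> 0"
  have p: "p \<ge> 2" "odd p"
    using assms primes_dvd_imp_eq[of 2 p] by (auto simp: prime_ge_2_nat)
  have "p * n \<ge> 2" using assms(1) p using mult_le_mono[of 1 p 2 n] by simp
  \<comment> \<open>The power identity is applied with 2 in place of \<open>n\<close>, where the
    form is just \<open>x + y\<close>.\<close>
  have "\<not> p dvd 2"
    using assms by (auto simp: primes_dvd_imp_eq)
  then have "(x + y) * cyclotomic_form (2 * p) x y = x ^ p + y ^ p"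
    using cyclotomic_form_power[of 2 p x y] assms
    by (simp add: cyclotomic_form_2 mult.commute)
  \<comment> \<open>Oddness of \<open>p\<close> preserves the sign: \<open>t^p\<close> becomes
    \<open>- (x^p * y^p)\<close>, as the parametrization at \<open>x^p\<close>, \<open>y^p\<close>
    requires.\<close>
  then have "bipoly_eval (bipoly_subst (lucas_atom n) (var_s * lucas_atom (2 * p)) (var_t ^ p))
      (x + y) (- (x * y)) = bipoly_eval (lucas_atom n) (x ^ p + y ^ p) (- (x ^ p * y ^ p))"
    using p y
    by (simp add: bipoly_eval_subst bipoly_eval_lucas_atom power_mult_distrib)
  also have "\<dots> = cyclotomic_form n (x ^ p) (y ^ p)"
    using assms y by (intro bipoly_eval_lucas_atom) auto
  also have "\<dots> = cyclotomic_form (p * n) x y * cyclotomic_form n x y"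
    using assms by (intro cyclotomic_form_power) auto
  finally show "bipoly_eval (lucas_atom (p * n) * lucas_atom n) (x + y) (- (x * y)) =
      bipoly_eval (bipoly_subst (lucas_atom n) (var_s * lucas_atom (2 * p)) (var_t ^ p))
      (x + y) (- (x * y))"
    using assms y \<open>p * n \<ge> 2\<close> by (simp add: bipoly_eval_lucas_atom)
qed

lemma ratfun_eq_divide:
  assumes "f * g = h" and "g \<noteq> 0"
  shows "ratfun f = ratfun h / ratfun g"
  using assms by (simp add: ratfun_def eq_fract)

theorem theorem5p9:
  fixes n p :: nat
  assumes "n \<ge> 2" and "prime p" and "\<not> p dvd n"
  shows "lucas_atom n \<noteq> 0 \<and>
    ratfun (lucas_atom (p * n)) =
      (if p = 2
       then ratfun (bipoly_subst (lucas_atom n) (var_s ^ 2 + 2 * var_t) (- (var_t ^ 2)))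
              / ratfun (lucas_atom n)
       else ratfun (bipoly_subst (lucas_atom n) (var_s * lucas_atom (2 * p)) (var_t ^ p))
              / ratfun (lucas_atom n))"
  using assms lucas_atom_nonzero[of n]
  by (auto intro!: ratfun_eq_divide lucas_atom_mult_two lucas_atom_mult_odd_prime)

end
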